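(* Let $(c_n)_{n\ge 0}$ be the sequence of rational numbers determined by $c_0=1$ and $$\sum_{k=0}^{N}\frac{c_k}{N+k+1}=0\qquad (N\ge 1).$$ Then $c_n=O(n^{-2})$ as $n\to\infty$.
   Context: The recurrence determines each $c_N$ uniquely since the coefficient of $c_N$ in the $N$-th equation is $1/(2N+1)\neq 0$. *)

theory Defs
  imports Complex_Main "HOL-Library.Landau_Symbols"
begin

end

theory Submission
  imports Defs "HOL-Real_Asymp.Real_Asymp"
begin

text \<open>
  Let \<open>C\<close> be the partial sums of \<open>c\<close> and \<open>D\<close> the partial sums of \<open>C\<close>. Summing the defining equation by
  parts twice gives
  \<open>D (n + 1) - D n = - (D n / 2 + (\<Sum>k<n. ker n k * D k)) / (n + 1)\<close>, where \<open>ker n k\<close> is close to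
  \<open>(1 / n) * 4 / (1 + k / n) ^ 3\<close>. In logarithmic time this is a delay equation, and replacing
  \<open>4 / (1 + t) ^ 3\<close> by its midpoint value \<open>32 / 27\<close> turns it into a two-dimensional linear system for
  \<open>D n\<close> and the mean \<open>m n\<close> of \<open>D 0, \<dots>, D (n - 1)\<close>, with eigenvalues \<open>- 3 / 4 \<plusminus> \<i> \<sigma>\<close>,
  \<open>\<sigma>\<^sup>2 = 485 / 432\<close>. The replacement error is at most about \<open>13 / 18\<close> times the maximum of \<open>\<bar>D\<bar>\<close>. Since
  \<open>\<bar>D\<bar> \<le> sqrt (512 / 485) * \<bar>z\<bar>\<close> for the eigencoordinate \<open>z\<close>, the damping wins because
  \<open>(13 / 18) / (3 / 4) * sqrt (512 / 485) < 0.99\<close>, so \<open>D\<close> is bounded. The recurrence then yields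
  \<open>C n = O(1 / n)\<close>, and its differences \<open>c n = O(1 / n\<^sup>2)\<close>.
\<close>

section \<open>Summation by parts and the kernel\<close>

lemma sum_mult_by_parts:
  fixes a b :: "nat \<Rightarrow> real"
  shows "(\<Sum>k\<le>n. a k * b k) = (\<Sum>k\<le>n. a k) * b n + (\<Sum>k<n. (\<Sum>j\<le>k. a j) * (b k - b (Suc k)))"
  by (induction n) (simp_all add: algebra_simps)

definition psum :: "(nat \<Rightarrow> real) \<Rightarrow> nat \<Rightarrow> real" where
  "psum a n = (\<Sum>k\<le>n. a k)"

lemma psum_Suc: "psum a (Suc n) = psum a n + a (Suc n)"
  by (simp add: psum_def)

text \<open>The second difference in \<open>k\<close> of \<open>1 / (n + k + 2)\<close>, scaled by
  \<open>(n + 1) * (2 * n + 3)\<close>.\<close>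

definition ker :: "nat \<Rightarrow> nat \<Rightarrow> real" where
  "ker n k = 2 * (real n + 1) * (2 * real n + 3)
    / ((real n + real k + 2) * (real n + real k + 3) * (real n + real k + 4))"

text \<open>Closed form of the infinite sum of \<open>ker n j\<close> over
  \<open>j \<ge> k\<close>.\<close>

definition ker_tail :: "nat \<Rightarrow> nat \<Rightarrow> real" where
  "ker_tail n k = (real n + 1) * (2 * real n + 3) / ((real n + real k + 2) * (real n + real k + 3))"

lemma ker_telescope: "ker n k = ker_tail n k - ker_tail n (Suc k)"
proof -
  define x where "x = real n + real k + 2"
  have "x > 0" by (simp add: x_def)
  then have "2 * y * w / (x * (x + 1) * (x + 2)) = y * w / (x * (x + 1)) - y * w / ((x + 1) * (x + 2))" for y w
    by (simp add: divide_simps) (simp add: algebra_simps)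
  from this[of "real n + 1" "2 * real n + 3"] show ?thesis
    by (simp add: ker_def ker_tail_def x_def add_ac)
qed

lemma sum_ker:
  assumes "p \<le> m"
  shows "(\<Sum>k=p..<m. ker n k) = ker_tail n p - ker_tail n m"
  using assms by (induction m rule: dec_induct) (simp_all add: ker_telescope)

lemma ker_nonneg: "ker n k \<ge> 0"
  by (simp add: ker_def)

lemma ker_antimono:
  assumes "k \<le> l"
  shows "ker n l \<le> ker n k"
  unfolding ker_def using assms
  by (intro divide_left_mono mult_mono mult_nonneg_nonneg mult_pos_pos) auto

lemma sum_ker_le: "(\<Sum>k<n. ker n k) \<le> 2"
proof -
  have "(\<Sum>k<n. ker n k) = ker_tail n 0 - ker_tail n n"
    using sum_ker[of 0 n n] by (simp add: lessThan_atLeast0)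
  also have "\<dots> \<le> ker_tail n 0"
    by (simp add: ker_tail_def)
  also have "\<dots> \<le> 2"
    by (simp add: ker_tail_def divide_simps) (simp add: algebra_simps)
  finally show ?thesis .
qed

section \<open>Distance of the kernel from a constant\<close>

text \<open>Pivot at \<open>p\<close>: by monotonicity \<open>ker n k - ker n p\<close> changes sign
  only there, so these deviations sum by telescoping. For \<open>p\<close> near \<open>n / 2\<close>
  the term with \<open>n - 2 * p\<close> is negligible.\<close>

lemma ker_deviation_le:
  fixes n p :: nat
  assumes "p \<le> n" "n > 0"
  shows "(\<Sum>k<n. \<bar>ker n k - A / n\<bar>) \<le>
     ker_tail n 0 - 2 * ker_tail n p + ker_tail n n + (real n - 2 * real p) * ker n p + \<bar>real n * ker n p - A\<bar>"
proof -
  have split: "(\<Sum>k<n. f k) = (\<Sum>k=0..<p. f k) + (\<Sum>k=p..<n. f k)" for f :: "nat \<Rightarrow> real"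
    using assms by (simp add: lessThan_atLeast0 sum.atLeastLessThan_concat)
  have "(\<Sum>k<n. \<bar>ker n k - A / n\<bar>) \<le> (\<Sum>k<n. \<bar>ker n k - ker n p\<bar> + \<bar>ker n p - A / n\<bar>)"
    by (intro sum_mono) linarith
  also have "\<dots> = (\<Sum>k<n. \<bar>ker n k - ker n p\<bar>) + n * \<bar>ker n p - A / n\<bar>"
    by (simp add: sum.distrib)
  also have "n * \<bar>ker n p - A / n\<bar> = \<bar>n * (ker n p - A / n)\<bar>"
    by (simp add: abs_mult)
  also have "n * (ker n p - A / n) = n * ker n p - A"
    using assms by (simp add: field_simps)
  also have "(\<Sum>k<n. \<bar>ker n k - ker n p\<bar>) = (\<Sum>k=0..<p. ker n k - ker n p) + (\<Sum>k=p..<n. ker n p - ker n k)"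
    unfolding split using ker_antimono[of _ p n] ker_antimono[of p _ n]
    by (intro arg_cong2[of _ _ _ _ "(+)"] sum.cong) auto
  also have "\<dots> = (\<Sum>k=0..<p. ker n k) - (\<Sum>k=p..<n. ker n k) + (real n - 2 * real p) * ker n p"
    using assms by (simp add: sum_subtractf of_nat_diff algebra_simps)
  also have "(\<Sum>k=0..<p. ker n k) - (\<Sum>k=p..<n. ker n k) = ker_tail n 0 - 2 * ker_tail n p + ker_tail n n"
    using assms by (simp add: sum_ker)
  finally show ?thesis .
qed

text \<open>Allows the pivot \<open>n div 2\<close> while keeping the bounds explicit in
  \<open>p\<close>, free of integer division.\<close>

lemma eventually_parityI:
  assumes "\<forall>\<^sub>F p in sequentially. P (2 * p)" "\<forall>\<^sub>F p in sequentially. P (2 * p + 1)"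
  shows "\<forall>\<^sub>F n::nat in sequentially. P n"
proof -
  obtain K where K: "\<And>p. p \<ge> K \<Longrightarrow> P (2 * p) \<and> P (2 * p + 1)"
    using eventually_conj[OF assms] by (auto simp: eventually_sequentially)
  have "P n" if "n \<ge> 2 * K" for n
  proof -
    have "n div 2 \<ge> K" using that by simp
    moreover have "n = 2 * (n div 2) \<or> n = 2 * (n div 2) + 1" by presburger
    ultimately show ?thesis using K by metis
  qed
  then show ?thesis by (auto simp: eventually_sequentially)
qed

lemma eventually_ker_deviation_less:
  assumes "\<phi> > 13 / 18"
  shows "\<forall>\<^sub>F n in sequentially. (\<Sum>k<n. \<bar>ker n k - (32 / 27) / n\<bar>) < \<phi>"
proof (rule eventually_parityI)
  let ?b = "\<lambda>n p. ker_tail n 0 - 2 * ker_tail n p + ker_tail n n + (real n - 2 * real p) * ker n p + \<bar>real n * ker n p - 32 / 27\<bar>"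
  \<comment> \<open>Asymptotically \<open>ker_tail n (t * n)\<close> is
    \<open>2 / (1 + t)^2\<close>, so the tail terms give \<open>2 - 16/9 + 1/2 = 13/18\<close>. The
    last summand vanishes since \<open>n * ker n p\<close> tends to \<open>32/27\<close>.\<close>
  have "(\<lambda>p. ?b (2 * p) p) \<longlonglongrightarrow> 13 / 18"
    unfolding ker_def ker_tail_def by real_asymp
  then have "\<forall>\<^sub>F p in sequentially. ?b (2 * p) p < \<phi>"
    using assms by (rule order_tendstoD)
  then show "\<forall>\<^sub>F p in sequentially. (\<Sum>k<2 * p. \<bar>ker (2 * p) k - (32 / 27) / real (2 * p)\<bar>) < \<phi>"
    using eventually_gt_at_top[of 0]
  proof eventually_elim
    case (elim p)
    show ?case
      by (rule le_less_trans[OF ker_deviation_le elim(1)]) (use elim(2) in simp_all)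
  qed
  have "(\<lambda>p. ?b (2 * p + 1) p) \<longlonglongrightarrow> 13 / 18"
    unfolding ker_def ker_tail_def by real_asymp
  then have "\<forall>\<^sub>F p in sequentially. ?b (2 * p + 1) p < \<phi>"
    using assms by (rule order_tendstoD)
  then show "\<forall>\<^sub>F p in sequentially. (\<Sum>k<2 * p + 1. \<bar>ker (2 * p + 1) k - (32 / 27) / real (2 * p + 1)\<bar>) < \<phi>"
  proof eventually_elim
    case (elim p)
    show ?case
      by (rule le_less_trans[OF ker_deviation_le elim]) simp_all
  qed
qed

section \<open>Recurrence for the double partial sums\<close>

lemma psum_psum_rec:
  assumes eq: "(\<Sum>k\<le>Suc n. c k / real (Suc n + k + 1)) = 0"
  shows "psum c (Suc n) = - (psum (psum c) n / 2 + (\<Sum>k<n. ker n k * psum (psum c) k)) / real (n + 1)"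
proof -
  define b where "b k = 1 / (real n + real k + 2)" for k
  define b' where "b' k = 1 / ((real n + real k + 2) * (real n + real k + 3))" for k
  \<comment> \<open>This scale gives \<open>psum c (Suc n)\<close> the coefficient
    \<open>n + 1\<close> and turns the differences of \<open>b'\<close> into
    \<open>ker\<close>.\<close>
  define w where "w = (real n + 1) * (2 * real n + 3)"
  have b': "b k - b (Suc k) = b' k" for k
    by (simp add: b_def b'_def divide_simps)
  have ker: "ker n k = w * (b' k - b' (Suc k))" for k
    by (simp add: ker_telescope ker_tail_def b'_def w_def right_diff_distrib)
  have "0 = (\<Sum>k\<le>Suc n. c k * b k)"
    using eq by (simp add: b_def add_ac)
  also have "\<dots> = psum c (Suc n) * b (Suc n) + (\<Sum>k\<le>n. psum c k * b' k)"
    by (subst sum_mult_by_parts) (simp add: psum_def b' lessThan_Suc_atMost)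
  also have "(\<Sum>k\<le>n. psum c k * b' k)
      = psum (psum c) n * b' n + (\<Sum>k<n. psum (psum c) k * (b' k - b' (Suc k)))"
    by (subst sum_mult_by_parts) (simp add: psum_def)
  finally have "0 = w * (psum c (Suc n) * b (Suc n) + (psum (psum c) n * b' n
      + (\<Sum>k<n. psum (psum c) k * (b' k - b' (Suc k)))))"
    by simp
  also have "\<dots> = (w * b (Suc n)) * psum c (Suc n) + (w * b' n) * psum (psum c) n
      + (\<Sum>k<n. ker n k * psum (psum c) k)"
    by (simp add: ker distrib_left sum_distrib_left mult_ac)
  also have "w * b (Suc n) = real n + 1"
    by (simp add: w_def b_def field_simps)
  also have "w * b' n = 1 / 2"
    by (simp add: w_def b'_def divide_simps)
  finally have "(real n + 1) * psum c (Suc n) = - (psum (psum c) n / 2 + (\<Sum>k<n. ker n k * psum (psum c) k))"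
    by simp
  then show ?thesis
    by (simp add: field_simps)
qed

section \<open>Boundedness of the double partial sums\<close>

text \<open>The squared modulus is \<open>1 - 3 / (2 * N) + (91/54) / N^2\<close>. Weakening
  \<open>3/4\<close> to \<open>0.745\<close> frees \<open>0.01 / N\<close>, which absorbs the
  quadratic terms for such \<open>N\<close>.\<close>

lemma norm_eigenvalue_step_le:
  assumes "N \<ge> 200"
  shows "norm (1 + Complex (-3/4) (sqrt (485/432)) / complex_of_real N) \<le> 1 - 0.745 / N"
proof (rule power2_le_imp_le)
  have N: "N > 0" using assms by simp
  have "(norm (1 + Complex (-3/4) (sqrt (485/432)) / complex_of_real N))\<^sup>2
      = (1 - 3 / (4 * N))\<^sup>2 + (sqrt (485/432) / N)\<^sup>2"
    by (simp add: cmod_power2 Re_divide_of_real Im_divide_of_real)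
  also have "\<dots> = (1 - 0.745 / N)\<^sup>2 - (0.01 * N - (91/54 - 0.745\<^sup>2)) / N\<^sup>2"
    using N by (simp add: power_divide divide_simps) (simp add: power2_eq_square algebra_simps)
  also have "\<dots> \<le> (1 - 0.745 / N)\<^sup>2"
    using assms by (simp add: power2_eq_square)
  finally show "(norm (1 + Complex (-3/4) (sqrt (485/432)) / complex_of_real N))\<^sup>2 \<le> (1 - 0.745 / N)\<^sup>2" .
  show "0 \<le> 1 - 0.745 / N" using assms by (simp add: field_simps)
qed

text \<open>Completing the square: \<open>512/485\<close> times the squared norm exceeds
  \<open>d^2\<close> by a multiple of a square, and \<open>1.0275\<close> rounds
  \<open>sqrt (512/485)\<close> up.\<close>

lemma abs_le_norm_eigencoordinate:
  "\<bar>d\<bar> \<le> 1.0275 * norm (Complex (d - m / 4) (sqrt (485/432) * m))"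
proof (rule power2_le_imp_le)
  let ?z = "Complex (d - m / 4) (sqrt (485/432) * m)"
  define Z where "Z = (norm ?z)\<^sup>2"
  have "Z = (d - m / 4)\<^sup>2 + 485/432 * m\<^sup>2"
    by (simp add: Z_def cmod_power2 power_mult_distrib)
  then have "512/485 * Z = d\<^sup>2 + 27/485 * (d - 128/27 * m)\<^sup>2"
    by (simp add: power2_eq_square algebra_simps)
  then have "d\<^sup>2 \<le> 512/485 * Z"
    by simp
  also have "512/485 * Z \<le> 1.0275\<^sup>2 * Z"
    by (intro mult_right_mono) (simp_all add: power2_eq_square Z_def)
  finally show "\<bar>d\<bar>\<^sup>2 \<le> (1.0275 * norm ?z)\<^sup>2"
    unfolding power_mult_distrib power2_abs Z_def .
qed simp

lemma bounded_if_rec: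
  assumes rec: "\<And>n. D (Suc n) = D n - (D n / 2 + (\<Sum>k<n. ker n k * D k)) / real (n + 1)"
  shows "\<exists>M. \<forall>n. \<bar>D n\<bar> \<le> M"
proof -
  define m where "m n = (\<Sum>k<n. D k) / real n" for n
  define \<sigma> where "\<sigma> = sqrt (485/432)"
  \<comment> \<open>Apart from \<open>f\<close>, the increments of \<open>(D, m)\<close> times
    \<open>n + 1\<close> are \<open>(- D/2 - 32/27 * m, D - m)\<close>. The row
    \<open>(1, -1/4 + \<i> * \<sigma>)\<close> is a left eigenvector of this matrix for
    \<open>-3/4 + \<i> * \<sigma>\<close>.\<close>
  define z where "z n = Complex (D n - m n / 4) (\<sigma> * m n)" for n
  define f where "f n = (\<Sum>k<n. (ker n k - (32/27) / real n) * D k)" for n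
  have \<sigma>: "\<sigma> * \<sigma> = 485/432" by (simp add: \<sigma>_def)
  \<comment> \<open>At \<open>n = 0\<close>, division by zero gives \<open>m 0 = 0\<close>, and both
    sides equal \<open>D 0\<close>.\<close>
  have m_Suc: "m (Suc n) = m n + (D n - m n) / real (n + 1)" for n
    by (cases "n = 0") (simp_all add: m_def divide_simps, simp add: algebra_simps)
  have f: "(\<Sum>k<n. ker n k * D k) = f n + 32/27 * m n" for n
    by (simp add: f_def m_def left_diff_distrib sum_subtractf sum_distrib_left sum_divide_distrib)
  have D_Suc: "D (Suc n) = D n - (D n / 2 + 32/27 * m n + f n) / real (n + 1)" for n
    by (simp add: rec f add_ac)
  have z_Suc: "z (Suc n) = (1 + Complex (-3/4) \<sigma> / complex_of_real (real (n + 1))) * z n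
      - complex_of_real (f n / real (n + 1))" for n
  proof (rule complex_eqI)
    define N where "N = real (n + 1)"
    have N: "N \<noteq> 0" by (simp add: N_def)
    have D': "D (Suc n) = D n - (D n / 2 + 32/27 * m n + f n) / N"
      and m': "m (Suc n) = m n + (D n - m n) / N"
      by (simp_all only: D_Suc m_Suc N_def)
    have Re_eq: "Re (z (Suc n)) = D n - m n / 4 + (- 3/4 * D n + (1/4 - 32/27) * m n - f n) / N"
      using N by (simp add: z_def D' m' field_simps)
    have "Re ((1 + Complex (-3/4) \<sigma> / complex_of_real N) * z n - complex_of_real (f n / N))
        = (1 - 3/4 / N) * (D n - m n / 4) - \<sigma> * \<sigma> * m n / N - f n / N"
      by (simp add: z_def Re_divide_of_real Im_divide_of_real)
    also have "\<dots> = D n - m n / 4 + (- 3/4 * D n + (1/4 - 32/27) * m n - f n) / N"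
      unfolding \<sigma> using N by (simp add: field_simps)
    finally show "Re (z (Suc n)) = Re ((1 + Complex (-3/4) \<sigma> / complex_of_real (real (n + 1))) * z n
      - complex_of_real (f n / real (n + 1)))"
      using Re_eq unfolding N_def by simp
    have "Im ((1 + Complex (-3/4) \<sigma> / complex_of_real N) * z n - complex_of_real (f n / N))
        = (1 - 3/4 / N) * (\<sigma> * m n) + \<sigma> / N * (D n - m n / 4)"
      by (simp add: z_def Re_divide_of_real Im_divide_of_real)
    also have "\<dots> = Im (z (Suc n))"
      using N by (simp add: z_def m' field_simps)
    finally show "Im (z (Suc n)) = Im ((1 + Complex (-3/4) \<sigma> / complex_of_real (real (n + 1))) * z n
      - complex_of_real (f n / real (n + 1)))"
      unfolding N_def by simp
  qed
  \<comment> \<open>\<open>0.7235\<close> lies above \<open>13 / 18\<close> and \<open>0.745\<close> below \<open>3 / 4\<close>, with \<open>1.0275 * 0.7235 / 0.745 < 1\<close>.\<close>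
  have "\<forall>\<^sub>F n in sequentially. (\<Sum>k<n. \<bar>ker n k - (32/27) / real n\<bar>) < 0.7235 \<and> n \<ge> 200"
    by (intro eventually_conj eventually_ker_deviation_less eventually_ge_at_top) simp
  then obtain n0 where n0: "\<And>n. n \<ge> n0 \<Longrightarrow> (\<Sum>k<n. \<bar>ker n k - (32/27) / real n\<bar>) < 0.7235 \<and> n \<ge> 200"
    by (auto simp: eventually_sequentially)
  \<comment> \<open>The factor 2 gives \<open>norm (z n0) \<le> M / 2\<close>, safely below the
    bound of the induction.\<close>
  define M where "M = (\<Sum>k\<le>n0. \<bar>D k\<bar>) + 2 * norm (z n0)"
  have M0: "M \<ge> 0" by (simp add: M_def add_nonneg_nonneg sum_nonneg)
  \<comment> \<open>The bound on \<open>norm (z n)\<close> is the fixed point of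
    \<open>x \<mapsto> (1 - 0.745 / N) * x + 0.7235 * M / N\<close>, hence preserved for every
    \<open>N\<close>.\<close>
  have "norm (z n) \<le> 0.7235 / 0.745 * M \<and> (\<forall>k\<le>n. \<bar>D k\<bar> \<le> M)" if "n \<ge> n0" for n
    using that
  proof (induction n rule: dec_induct)
    case base
    have "2 * norm (z n0) \<le> M" by (simp add: M_def sum_nonneg)
    moreover have "\<bar>D k\<bar> \<le> M" if "k \<le> n0" for k
    proof -
      have "\<bar>D k\<bar> \<le> (\<Sum>k\<le>n0. \<bar>D k\<bar>)"
        using that by (intro member_le_sum) auto
      also have "\<dots> \<le> M" by (simp add: M_def)
      finally show ?thesis .
    qed
    ultimately show ?case using M0 by simp
  next
    case (step n)
    define N where "N = real (n + 1)"
    have N: "N \<ge> 200" using n0[OF step(1)] by (simp add: N_def)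
    have "\<bar>f n\<bar> \<le> (\<Sum>k<n. \<bar>ker n k - (32/27) / real n\<bar> * M)"
      unfolding f_def using step.IH
      by (intro order_trans[OF sum_abs] sum_mono) (auto simp: abs_mult intro!: mult_left_mono)
    also have "\<dots> \<le> 0.7235 * M"
      unfolding sum_distrib_right[symmetric] using n0[OF step(1)] M0 by (intro mult_right_mono) auto
    finally have f_le: "\<bar>f n\<bar> \<le> 0.7235 * M" .
    have "norm (z (Suc n)) \<le> norm (1 + Complex (-3/4) \<sigma> / complex_of_real N) * norm (z n) + \<bar>f n\<bar> / N"
      unfolding z_Suc N_def
      by (rule order_trans[OF norm_triangle_ineq4]) (simp add: norm_mult norm_divide del: of_nat_add of_nat_Suc)
    also have "\<dots> \<le> (1 - 0.745 / N) * (0.7235 / 0.745 * M) + 0.7235 * M / N"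
      using norm_eigenvalue_step_le[OF N] step.IH f_le N unfolding \<sigma>_def
      by (intro add_mono mult_mono divide_right_mono) (auto simp: field_simps)
    also have "\<dots> = 0.7235 / 0.745 * M"
      using N by (simp add: field_simps)
    finally have z_le: "norm (z (Suc n)) \<le> 0.7235 / 0.745 * M" .
    have "\<bar>D (Suc n)\<bar> \<le> 1.0275 * norm (z (Suc n))"
      unfolding z_def \<sigma>_def by (rule abs_le_norm_eigencoordinate)
    also have "\<dots> \<le> M"
      using z_le M0 by simp
    finally show ?case using z_le step.IH by (auto simp: le_Suc_eq)
  qed
  then have "\<bar>D n\<bar> \<le> M" for n
    by (meson nle_le order_refl)
  then show ?thesis by blast
qed

section \<open>From bounded double sums to the decay of \<open>c\<close>\<close>

text \<open>Over the common denominator \<open>P\<close> of degree four the quadratic parts of the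
  numerators cancel, leaving a linear one. This gains a factor \<open>1 / n\<close> over the
  individual terms.\<close>

lemma ker_step_le:
  assumes "k < n"
  shows "\<bar>ker n k / real (n + 1) - ker (Suc n) k / real (n + 2)\<bar> \<le> 10 / real (n + 1) ^ 3"
proof -
  define x where "x = real n + real k"
  define N where "N = real n + 1"
  define P where "P = (x + 2) * (x + 3) * (x + 4) * (x + 5)"
  have x: "x \<ge> 0" and N: "N > 0" and Nx: "N \<le> x + 2" by (auto simp: x_def N_def)
  have P: "P > 0" using x by (simp add: P_def)
  have "ker n k / real (n + 1) = 2 * (2 * real n + 3) / ((x + 2) * (x + 3) * (x + 4))"
    by (simp add: ker_def x_def divide_simps) (simp add: algebra_simps)
  also have "\<dots> = 2 * (2 * real n + 3) * (x + 5) / P"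
    using x by (simp add: P_def divide_simps)
  finally have 1: "ker n k / real (n + 1) = 2 * (2 * real n + 3) * (x + 5) / P" .
  have "ker (Suc n) k / real (n + 2) = 2 * (2 * real n + 5) / ((x + 3) * (x + 4) * (x + 5))"
    by (simp add: ker_def x_def divide_simps) (simp add: algebra_simps)
  also have "\<dots> = 2 * (2 * real n + 5) * (x + 2) / P"
    using x by (simp add: P_def divide_simps)
  finally have 2: "ker (Suc n) k / real (n + 2) = 2 * (2 * real n + 5) * (x + 2) / P" .
  have "ker n k / real (n + 1) - ker (Suc n) k / real (n + 2) = 2 * (4 * real n - 2 * real k + 5) / P"
    unfolding 1 2 diff_divide_distrib[symmetric] by (simp add: x_def algebra_simps)
  then have "\<bar>ker n k / real (n + 1) - ker (Suc n) k / real (n + 2)\<bar> = 2 * (4 * real n - 2 * real k + 5) / P"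
    using assms P by (simp only:) simp
  also have "\<dots> \<le> 10 * N / P"
    using P by (intro divide_right_mono) (auto simp: N_def)
  also have "\<dots> \<le> 10 * N / (N * N * N * N)"
    unfolding P_def using N Nx x by (intro divide_left_mono mult_mono mult_pos_pos) auto
  also have "\<dots> = 10 / N ^ 3"
    using N by (simp add: power3_eq_cube)
  finally show ?thesis by (simp add: N_def add_ac)
qed

lemma abs_le_if_psum_psum_bounded:
  assumes rec: "\<And>n. psum c (Suc n)
      = - (psum (psum c) n / 2 + (\<Sum>k<n. ker n k * psum (psum c) k)) / real (n + 1)"
    and M: "\<And>n. \<bar>psum (psum c) n\<bar> \<le> M"
  shows "\<bar>c (n + 2)\<bar> \<le> 13 * M / real (n + 1) ^ 2"
proof -
  define D where "D = psum (psum c)"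
  define N where "N = real n + 1"
  have N: "N > 0" "real (n + 1) = N" "real (n + 2) = N + 1" "real (Suc n + 1) = N + 1"
    by (simp_all add: N_def)
  have D: "\<bar>D k\<bar> \<le> M" for k using M by (simp add: D_def)
  have M0: "M \<ge> 0" using D[of 0] by linarith
  have "\<bar>\<Sum>k<n. ker n k * D k\<bar> \<le> (\<Sum>k<n. ker n k * M)"
    using D by (intro order_trans[OF sum_abs] sum_mono) (auto simp: abs_mult ker_nonneg intro!: mult_left_mono)
  also have "\<dots> \<le> 2 * M"
    unfolding sum_distrib_right[symmetric] using M0 sum_ker_le by (intro mult_right_mono) auto
  finally have "\<bar>D n / 2 + (\<Sum>k<n. ker n k * D k)\<bar> \<le> 3 * M"
    using D[of n] by linarith
  then have C: "\<bar>psum c (Suc n)\<bar> \<le> 3 * M / N"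
    unfolding rec D_def[symmetric] N abs_divide abs_minus_cancel using N(1) by (simp add: divide_right_mono)
  define T where "T = (\<Sum>k<n. (ker n k / N - ker (Suc n) k / (N + 1)) * D k)"
  have "\<bar>T\<bar> \<le> (\<Sum>k<n. 10 / N ^ 3 * M)"
    unfolding T_def
  proof (intro order_trans[OF sum_abs] sum_mono)
    fix k assume "k \<in> {..<n}"
    then have "\<bar>ker n k / N - ker (Suc n) k / (N + 1)\<bar> \<le> 10 / N ^ 3"
      using ker_step_le[of k n] unfolding N by simp
    then show "\<bar>(ker n k / N - ker (Suc n) k / (N + 1)) * D k\<bar> \<le> 10 / N ^ 3 * M"
      unfolding abs_mult using D N(1) by (intro mult_mono) auto
  qed
  also have "\<dots> \<le> N * (10 / N ^ 3 * M)"
    unfolding sum_constant card_lessThan using M0 N(1)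
    by (intro mult_right_mono) (simp_all add: N_def)
  also have "\<dots> = 10 * M / N\<^sup>2"
    using N by (simp add: power3_eq_cube power2_eq_square)
  finally have T: "\<bar>T\<bar> \<le> 10 * M / N\<^sup>2" .
  have "ker (Suc n) n / (N + 1) = 2 / ((2 * N + 1) * (2 * N + 2))"
    by (simp add: ker_def N_def divide_simps)
  also have "\<dots> \<le> 2 / ((2 * N) * (2 * N))"
    using N by (intro divide_left_mono mult_mono mult_pos_pos) auto
  also have "\<dots> = 1 / 2 / N\<^sup>2" by (simp add: power2_eq_square)
  finally have "\<bar>ker (Suc n) n / (N + 1) * D n\<bar> \<le> 1 / 2 / N\<^sup>2 * M"
    unfolding abs_mult using D N ker_nonneg[of "Suc n" n] by (intro mult_mono) auto
  then have L: "\<bar>ker (Suc n) n / (N + 1) * D n\<bar> \<le> M / 2 / N\<^sup>2" by simp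
  have "\<bar>psum c (Suc n) / (2 * (N + 1))\<bar> \<le> (3 * M / N) / (2 * N)"
    unfolding abs_divide using C N M0 by (intro frac_le) auto
  then have C2: "\<bar>psum c (Suc n) / (2 * (N + 1))\<bar> \<le> 3 / 2 * M / N\<^sup>2"
    by (simp add: power2_eq_square)
  have "\<bar>D n / (2 * N * (N + 1))\<bar> \<le> M / (2 * N * N)"
    unfolding abs_divide using D N M0 by (intro frac_le) (auto simp: abs_mult)
  then have D2: "\<bar>D n / (2 * N * (N + 1))\<bar> \<le> M / 2 / N\<^sup>2"
    by (simp add: power2_eq_square mult.assoc)
  have D_Suc: "D (Suc n) = D n + psum c (Suc n)"
    unfolding D_def by (rule psum_Suc)
  have "c (n + 2) = psum c (Suc (Suc n)) - psum c (Suc n)"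
    by (simp add: psum_Suc)
  also have "\<dots> = (D n / 2 + (\<Sum>k<n. ker n k * D k)) / N
      - (D (Suc n) / 2 + (\<Sum>k<Suc n. ker (Suc n) k * D k)) / (N + 1)"
    unfolding rec[of n] rec[of "Suc n"] D_def[symmetric] N
    by (simp only: minus_divide_left[symmetric] minus_diff_minus minus_diff_eq)
  \<comment> \<open>The change splits into the boundary term, the drift \<open>T\<close> of the
    kernel (\<open>n\<close> terms of size \<open>N^(-3)\<close>), and the new summand
    \<open>k = n\<close>. In the boundary term \<open>D (Suc n) - D n = psum c (Suc n)\<close> is
    itself \<open>O(1 / N)\<close>.\<close>
  also have "\<dots> = (D n / 2 / N - D (Suc n) / 2 / (N + 1)) + T - ker (Suc n) n / (N + 1) * D n"
    by (simp add: T_def add_divide_distrib left_diff_distrib sum_subtractf sum_divide_distrib)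
  also have "D n / 2 / N - D (Suc n) / 2 / (N + 1) = D n / (2 * N * (N + 1)) - psum c (Suc n) / (2 * (N + 1))"
    unfolding D_Suc using N(1) by (simp add: divide_simps) (simp add: algebra_simps)
  finally have "\<bar>c (n + 2)\<bar> \<le> M / 2 / N\<^sup>2 + 3 / 2 * M / N\<^sup>2 + 10 * M / N\<^sup>2 + M / 2 / N\<^sup>2"
    using T L C2 D2 by linarith
  also have "\<dots> = 12.5 * M / N\<^sup>2"
    by (simp add: add_divide_distrib[symmetric])
  also have "\<dots> \<le> 13 * M / N\<^sup>2"
    using M0 by (intro divide_right_mono) auto
  finally show ?thesis unfolding N .
qed

theorem theorem1p2:
  fixes c :: "nat \<Rightarrow> rat"
  assumes "c 0 = 1"
    and "\<And>N::nat. N \<ge> 1 \<Longrightarrow> (\<Sum>k=0..N. c k / of_nat (N + k + 1)) = 0"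
  shows "(\<lambda>n. real_of_rat (c n)) \<in> O(\<lambda>n. 1 / real n ^ 2)"
proof -
  define a where "a n = real_of_rat (c n)" for n
  have "(\<Sum>k\<le>Suc n. a k / real (Suc n + k + 1)) = 0" for n
  proof -
    have "(\<Sum>k\<le>Suc n. a k / real (Suc n + k + 1)) = real_of_rat (\<Sum>k=0..Suc n. c k / of_nat (Suc n + k + 1))"
      unfolding of_rat_sum a_def of_rat_divide of_rat_of_nat_eq atMost_atLeast0 ..
    also have "\<dots> = 0"
      using assms(2)[of "Suc n"] by simp
    finally show ?thesis .
  qed
  then have rec: "psum a (Suc n)
      = - (psum (psum a) n / 2 + (\<Sum>k<n. ker n k * psum (psum a) k)) / real (n + 1)" for n
    by (rule psum_psum_rec)
  have "psum (psum a) (Suc n) = psum (psum a) n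
      - (psum (psum a) n / 2 + (\<Sum>k<n. ker n k * psum (psum a) k)) / real (n + 1)" for n
    using rec[of n] psum_Suc[of "psum a" n] by (simp only: minus_divide_left[symmetric] add_uminus_conv_diff)
  from bounded_if_rec[of "psum (psum a)", OF this]
  obtain M where M: "\<And>n. \<bar>psum (psum a) n\<bar> \<le> M"
    by blast
  have M0: "M \<ge> 0" using M[of 0] by linarith
  \<comment> \<open>\<open>52 = 4 * 13\<close>, since \<open>n - 1 \<ge> n / 2\<close> for
    \<open>n \<ge> 2\<close>.\<close>
  have "\<bar>a n\<bar> \<le> 52 * M * (1 / real n ^ 2)" if "n \<ge> 2" for n
  proof -
    obtain j where j: "n = j + 2" using le_Suc_ex[OF \<open>n \<ge> 2\<close>] by (auto simp: add.commute)
    have "\<bar>a n\<bar> \<le> 13 * M / real (j + 1) ^ 2"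
      unfolding j by (rule abs_le_if_psum_psum_bounded[OF rec M])
    also have "\<dots> \<le> 13 * M / (real n / 2) ^ 2"
      using M0 by (intro divide_left_mono power_mono) (auto simp: j)
    also have "\<dots> = 52 * M * (1 / real n ^ 2)"
      by (simp add: power_divide)
    finally show ?thesis .
  qed
  then have "\<forall>\<^sub>F n in sequentially. norm (a n) \<le> 52 * M * norm (1 / real n ^ 2)"
    by (intro eventually_sequentiallyI[of 2]) simp
  then show ?thesis
    unfolding a_def by (rule bigoI)
qed

end
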